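(* Let $\iota\colon\mathbf{A}\hookrightarrow\mathbf{A}^{\Delta}$ be a commutative complemented Dedekind--MacNeille completion of a commutative bimonoid $\mathbf{A}$. Then the following are equivalent: (i) each join which exists in $\mathbf{A}$ is admissible; (ii) $\iota$ preserves all joins which exist in $\mathbf{A}$; (iii) some embedding of $\mathbf{A}$ into a commutative complete complemented bimonoid preserves all joins which exist in $\mathbf{A}$.
   Context: A bimonoid $\langle A,\leq,\cdot,1,+,0\rangle$ is a poset with two monoid structures ($\cdot$ with unit $1$, $+$ with unit $0$), both operations order preserving in each argument, satisfying hemidistributivity $x\cdot(y+z)\leq(x\cdot y)+z$ and $(z+y)\cdot x\leq z+(y\cdot x)$; commutative if both operations are commutative. Homomorphisms preserve order, $\cdot,1,+,0$; embeddings are homomorphisms that are order embeddings. A join $\bigvee X$ existing in $\mathbf{A}$ is admissible if $(\bigvee X)\cdot y=\bigvee\{x\cdot y:x\in X\}$ for all $y\in\mathbf{A}$. In a commutative bimonoid, $y$ is a complement of $x$ if $x\cdot y\leq 0$ and $1\leq x+y$; unique if it exists, written $\overline{x}$; complemented means every element has a complement; complete means the order is a complete lattice. An embedding $e\colon\mathbf{A}\hookrightarrow\mathbf{C}$ of commutative bimonoids is a commutative $\Delta_1$-extension if the elements $e(a)\cdot\overline{e(b)}$ ($a,b\in\mathbf{A}$, complement existing in $\mathbf{C}$) are join dense and the elements $e(a)+\overline{e(b)}$ are meet dense in $\mathbf{C}$; it is a commutative complemented Dedekind--MacNeille completion if moreover $\mathbf{C}$ is complete and complemented. *)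

theory Defs
  imports "HOL-Algebra.Group"
begin

record 'a bimonoid = "'a gorder" +
  bmult :: "'a \<Rightarrow> 'a \<Rightarrow> 'a" (infixl \<open>\<cdot>\<index>\<close> 70)
  bone :: 'a (\<open>\<^bold>1\<index>\<close>)
  badd :: "'a \<Rightarrow> 'a \<Rightarrow> 'a" (infixl \<open>\<boxplus>\<index>\<close> 65)
  bzero :: 'a (\<open>\<^bold>0\<index>\<close>)

definition mult_reduct :: "('a, 'm) bimonoid_scheme \<Rightarrow> 'a monoid" where
  "mult_reduct B = \<lparr>carrier = carrier B, mult = bmult B, one = bone B\<rparr>"

definition add_reduct :: "('a, 'm) bimonoid_scheme \<Rightarrow> 'a monoid" where
  "add_reduct B = \<lparr>carrier = carrier B, mult = badd B, one = bzero B\<rparr>"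

locale bimonoid = partial_order B for B (structure) +
  assumes mult_monoid: "monoid (mult_reduct B)"
    and add_monoid: "monoid (add_reduct B)"
    and mult_mono: "\<lbrakk>x \<in> carrier B; x' \<in> carrier B; y \<in> carrier B; y' \<in> carrier B;
      x \<sqsubseteq> x'; y \<sqsubseteq> y'\<rbrakk> \<Longrightarrow> x \<cdot> y \<sqsubseteq> x' \<cdot> y'"
    and add_mono: "\<lbrakk>x \<in> carrier B; x' \<in> carrier B; y \<in> carrier B; y' \<in> carrier B;
      x \<sqsubseteq> x'; y \<sqsubseteq> y'\<rbrakk> \<Longrightarrow> x \<boxplus> y \<sqsubseteq> x' \<boxplus> y'"
    and hemidistrib_left: "\<lbrakk>x \<in> carrier B; y \<in> carrier B; z \<in> carrier B\<rbrakk> \<Longrightarrow>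
      x \<cdot> (y \<boxplus> z) \<sqsubseteq> (x \<cdot> y) \<boxplus> z"
    and hemidistrib_right: "\<lbrakk>x \<in> carrier B; y \<in> carrier B; z \<in> carrier B\<rbrakk> \<Longrightarrow>
      (z \<boxplus> y) \<cdot> x \<sqsubseteq> z \<boxplus> (y \<cdot> x)"

locale comm_bimonoid = bimonoid +
  assumes mult_comm: "\<lbrakk>x \<in> carrier B; y \<in> carrier B\<rbrakk> \<Longrightarrow> x \<cdot> y = y \<cdot> x"
    and add_comm: "\<lbrakk>x \<in> carrier B; y \<in> carrier B\<rbrakk> \<Longrightarrow> x \<boxplus> y = y \<boxplus> x"

definition bimonoid_hom ::
    "('a, 'm) bimonoid_scheme \<Rightarrow> ('b, 'n) bimonoid_scheme \<Rightarrow> ('a \<Rightarrow> 'b) \<Rightarrow> bool" where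
  "bimonoid_hom A B h \<longleftrightarrow>
     h \<in> carrier A \<rightarrow> carrier B \<and>
     (\<forall>x\<in>carrier A. \<forall>y\<in>carrier A. x \<sqsubseteq>\<^bsub>A\<^esub> y \<longrightarrow> h x \<sqsubseteq>\<^bsub>B\<^esub> h y) \<and>
     (\<forall>x\<in>carrier A. \<forall>y\<in>carrier A. h (x \<cdot>\<^bsub>A\<^esub> y) = h x \<cdot>\<^bsub>B\<^esub> h y) \<and>
     h \<^bold>1\<^bsub>A\<^esub> = \<^bold>1\<^bsub>B\<^esub> \<and>
     (\<forall>x\<in>carrier A. \<forall>y\<in>carrier A. h (x \<boxplus>\<^bsub>A\<^esub> y) = h x \<boxplus>\<^bsub>B\<^esub> h y) \<and>
     h \<^bold>0\<^bsub>A\<^esub> = \<^bold>0\<^bsub>B\<^esub>"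

definition bimonoid_embedding ::
    "('a, 'm) bimonoid_scheme \<Rightarrow> ('b, 'n) bimonoid_scheme \<Rightarrow> ('a \<Rightarrow> 'b) \<Rightarrow> bool" where
  "bimonoid_embedding A B e \<longleftrightarrow>
     bimonoid_hom A B e \<and>
     (\<forall>x\<in>carrier A. \<forall>y\<in>carrier A. x \<sqsubseteq>\<^bsub>A\<^esub> y \<longleftrightarrow> e x \<sqsubseteq>\<^bsub>B\<^esub> e y)"

text \<open>That \<open>s\<close> is the join of \<open>X\<close> in \<open>A\<close> is expressed by \<^const>\<open>is_lub\<close>; \<open>X\<close> may be empty.\<close>

definition admissible_join :: "('a, 'm) bimonoid_scheme \<Rightarrow> 'a \<Rightarrow> 'a set \<Rightarrow> bool" where
  "admissible_join A s X \<longleftrightarrow>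
     is_lub A s X \<and> (\<forall>y\<in>carrier A. is_lub A (s \<cdot>\<^bsub>A\<^esub> y) ((\<lambda>x. x \<cdot>\<^bsub>A\<^esub> y) ` X))"

definition all_joins_admissible :: "('a, 'm) bimonoid_scheme \<Rightarrow> bool" where
  "all_joins_admissible A \<longleftrightarrow>
     (\<forall>X s. X \<subseteq> carrier A \<longrightarrow> is_lub A s X \<longrightarrow> admissible_join A s X)"

definition preserves_joins ::
    "('a, 'm) bimonoid_scheme \<Rightarrow> ('b, 'n) bimonoid_scheme \<Rightarrow> ('a \<Rightarrow> 'b) \<Rightarrow> bool" where
  "preserves_joins A B h \<longleftrightarrow>
     (\<forall>X s. X \<subseteq> carrier A \<longrightarrow> is_lub A s X \<longrightarrow> is_lub B (h s) (h ` X))"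

definition is_complement :: "('a, 'm) bimonoid_scheme \<Rightarrow> 'a \<Rightarrow> 'a \<Rightarrow> bool" where
  "is_complement B x y \<longleftrightarrow>
     x \<in> carrier B \<and> y \<in> carrier B \<and> x \<cdot>\<^bsub>B\<^esub> y \<sqsubseteq>\<^bsub>B\<^esub> \<^bold>0\<^bsub>B\<^esub> \<and> \<^bold>1\<^bsub>B\<^esub> \<sqsubseteq>\<^bsub>B\<^esub> x \<boxplus>\<^bsub>B\<^esub> y"

lemma (in comm_bimonoid) complement_unique:
  assumes "is_complement B x y" and "is_complement B x z"
  shows "y = z"
proof -
  interpret M: monoid "mult_reduct B" by (rule mult_monoid)
  interpret S: monoid "add_reduct B" by (rule add_monoid)
  note M' = M.m_closed M.one_closed M.r_one and S' = S.m_closed S.one_closed S.l_one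
  note closed = M'[unfolded mult_reduct_def, simplified] S'[unfolded add_reduct_def, simplified]
  have le: "u \<sqsubseteq> v" if "is_complement B x u" "is_complement B x v" for u v
  proof -
    have c: "x \<in> carrier B" "u \<in> carrier B" "v \<in> carrier B" "x \<cdot> u \<sqsubseteq> \<^bold>0" "\<^bold>1 \<sqsubseteq> x \<boxplus> v"
      using that by (auto simp: is_complement_def)
    have "u \<cdot> \<^bold>1 \<sqsubseteq> u \<cdot> (x \<boxplus> v)" using c closed by (intro mult_mono) auto
    moreover have "u \<cdot> (x \<boxplus> v) \<sqsubseteq> (u \<cdot> x) \<boxplus> v" using c by (intro hemidistrib_left) auto
    moreover have "(u \<cdot> x) \<boxplus> v \<sqsubseteq> \<^bold>0 \<boxplus> v"
      using c closed mult_comm[of u x] by (intro add_mono) auto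
    ultimately have "u \<cdot> \<^bold>1 \<sqsubseteq> \<^bold>0 \<boxplus> v" using c closed by (meson le_trans)
    then show ?thesis using c closed by simp
  qed
  show ?thesis
    using le[OF assms] le[OF assms(2,1)] assms by (auto simp: is_complement_def)
qed

definition complemented :: "('a, 'm) bimonoid_scheme \<Rightarrow> bool" where
  "complemented B \<longleftrightarrow> (\<forall>x\<in>carrier B. \<exists>y. is_complement B x y)"

definition comm_complete_complemented_bimonoid :: "('a, 'm) bimonoid_scheme \<Rightarrow> bool" where
  "comm_complete_complemented_bimonoid B \<longleftrightarrow>
     comm_bimonoid B \<and> complete_lattice B \<and> complemented B"

definition join_dense :: "('a, 'm) gorder_scheme \<Rightarrow> 'a set \<Rightarrow> bool" where
  "join_dense L S \<longleftrightarrow>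
     S \<subseteq> carrier L \<and> (\<forall>c\<in>carrier L. \<exists>X\<subseteq>S. is_lub L c X)"

definition meet_dense :: "('a, 'm) gorder_scheme \<Rightarrow> 'a set \<Rightarrow> bool" where
  "meet_dense L S \<longleftrightarrow>
     S \<subseteq> carrier L \<and> (\<forall>c\<in>carrier L. \<exists>X\<subseteq>S. is_glb L c X)"

text \<open>In the sets below \<open>c\<close> is the complement of \<open>e b\<close> in \<open>C\<close>, unique by
  \<open>complement_unique\<close>.\<close>

definition comm_Delta1_extension ::
    "('a, 'm) bimonoid_scheme \<Rightarrow> ('c, 'n) bimonoid_scheme \<Rightarrow> ('a \<Rightarrow> 'c) \<Rightarrow> bool" where
  "comm_Delta1_extension A C e \<longleftrightarrow>
     comm_bimonoid A \<and> comm_bimonoid C \<and> bimonoid_embedding A C e \<and>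
     (\<forall>b\<in>carrier A. \<exists>c. is_complement C (e b) c) \<and>
     join_dense C {e a \<cdot>\<^bsub>C\<^esub> c | a b c.
       a \<in> carrier A \<and> b \<in> carrier A \<and> is_complement C (e b) c} \<and>
     meet_dense C {e a \<boxplus>\<^bsub>C\<^esub> c | a b c.
       a \<in> carrier A \<and> b \<in> carrier A \<and> is_complement C (e b) c}"

definition comm_complemented_DM_completion ::
    "('a, 'm) bimonoid_scheme \<Rightarrow> ('c, 'n) bimonoid_scheme \<Rightarrow> ('a \<Rightarrow> 'c) \<Rightarrow> bool" where
  "comm_complemented_DM_completion A C e \<longleftrightarrow>
     comm_Delta1_extension A C e \<and> comm_complete_complemented_bimonoid C"

end

theory Submission
  imports Defs
begin

text \<open>Complements residuate multiplication: \<open>x \<cdot> y \<sqsubseteq> z\<close> iff \<open>x \<sqsubseteq> z \<boxplus> c\<close>, where \<open>c\<close> is the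
  complement of \<open>y\<close>. If \<open>A\<close> embeds join-preservingly into a complemented bimonoid, multiplication
  by \<open>y\<close> is a left adjoint there, so joins of \<open>A\<close> are admissible. Conversely, every upper bound of
  \<open>\<iota> ` X\<close> in the completion is a meet of elements \<open>\<iota> a \<boxplus> c\<close> with \<open>c\<close> the complement of some
  \<open>\<iota> b\<close>, and by residuation such an element bounds \<open>\<iota> x\<close> iff \<open>x \<cdot> b \<sqsubseteq> a\<close> in \<open>A\<close>; admissibility of
  the join \<open>s\<close> of \<open>X\<close> then yields \<open>s \<cdot> b \<sqsubseteq> a\<close>, that is, \<open>\<iota> s \<sqsubseteq> \<iota> a \<boxplus> c\<close>.\<close>

context bimonoid
begin

lemma mult_closed: "\<lbrakk>x \<in> carrier B; y \<in> carrier B\<rbrakk> \<Longrightarrow> x \<cdot> y \<in> carrier B"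
  using monoid.m_closed[OF mult_monoid] by (simp add: mult_reduct_def)

lemma add_closed: "\<lbrakk>x \<in> carrier B; y \<in> carrier B\<rbrakk> \<Longrightarrow> x \<boxplus> y \<in> carrier B"
  using monoid.m_closed[OF add_monoid] by (simp add: add_reduct_def)

lemma one_closed: "\<^bold>1 \<in> carrier B"
  using monoid.one_closed[OF mult_monoid] by (simp add: mult_reduct_def)

lemma zero_closed: "\<^bold>0 \<in> carrier B"
  using monoid.one_closed[OF add_monoid] by (simp add: add_reduct_def)

lemma mult_one_right: "x \<in> carrier B \<Longrightarrow> x \<cdot> \<^bold>1 = x"
  using monoid.r_one[OF mult_monoid] by (simp add: mult_reduct_def)

lemma add_zero_right: "x \<in> carrier B \<Longrightarrow> x \<boxplus> \<^bold>0 = x"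
  using monoid.r_one[OF add_monoid] by (simp add: add_reduct_def)

end

text \<open>\<open>Upper\<close> only tests members of \<open>X\<close> that lie in the carrier, so
  the inclusion hypothesis makes quantification over all of \<open>X\<close> equivalent.\<close>

lemma is_lub_iff:
  assumes "X \<subseteq> carrier L"
  shows "is_lub L s X \<longleftrightarrow> s \<in> carrier L \<and> (\<forall>x\<in>X. x \<sqsubseteq>\<^bsub>L\<^esub> s) \<and>
    (\<forall>u\<in>carrier L. (\<forall>x\<in>X. x \<sqsubseteq>\<^bsub>L\<^esub> u) \<longrightarrow> s \<sqsubseteq>\<^bsub>L\<^esub> u)"
  using assms unfolding least_def Upper_def by blast

lemma is_glb_iff:
  assumes "X \<subseteq> carrier L"
  shows "is_glb L s X \<longleftrightarrow> s \<in> carrier L \<and> (\<forall>x\<in>X. s \<sqsubseteq>\<^bsub>L\<^esub> x) \<and>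
    (\<forall>u\<in>carrier L. (\<forall>x\<in>X. u \<sqsubseteq>\<^bsub>L\<^esub> x) \<longrightarrow> u \<sqsubseteq>\<^bsub>L\<^esub> s)"
  using assms unfolding greatest_def Lower_def by blast

lemma (in comm_bimonoid) mult_le_iff_le_add_complement:
  assumes x: "x \<in> carrier B" and z: "z \<in> carrier B" and "is_complement B y c"
  shows "x \<cdot> y \<sqsubseteq> z \<longleftrightarrow> x \<sqsubseteq> z \<boxplus> c"
proof
  have y: "y \<in> carrier B" and c: "c \<in> carrier B" and yc: "y \<cdot> c \<sqsubseteq> \<^bold>0" "\<^bold>1 \<sqsubseteq> y \<boxplus> c"
    using assms(3) by (auto simp: is_complement_def)
  note cl = x y z c mult_closed add_closed one_closed zero_closed
  {
    assume le: "x \<cdot> y \<sqsubseteq> z"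
    have "x \<cdot> \<^bold>1 \<sqsubseteq> x \<cdot> (y \<boxplus> c)"
      by (rule mult_mono) (use cl yc in auto)
    moreover have "x \<cdot> (y \<boxplus> c) \<sqsubseteq> (x \<cdot> y) \<boxplus> c"
      by (rule hemidistrib_left) (use cl in auto)
    moreover have "(x \<cdot> y) \<boxplus> c \<sqsubseteq> z \<boxplus> c"
      by (rule add_mono) (use cl le in auto)
    ultimately have "x \<cdot> \<^bold>1 \<sqsubseteq> z \<boxplus> c"
      using cl by (meson le_trans)
    then show "x \<sqsubseteq> z \<boxplus> c"
      using x by (simp add: mult_one_right)
  }
  {
    assume le: "x \<sqsubseteq> z \<boxplus> c"
    have "x \<cdot> y \<sqsubseteq> (z \<boxplus> c) \<cdot> y"
      by (rule mult_mono) (use cl le in auto)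
    moreover have "(z \<boxplus> c) \<cdot> y \<sqsubseteq> z \<boxplus> (c \<cdot> y)"
      by (rule hemidistrib_right) (use cl in auto)
    moreover have "z \<boxplus> (c \<cdot> y) \<sqsubseteq> z \<boxplus> \<^bold>0"
      by (rule add_mono) (use cl yc mult_comm[of c y] in auto)
    ultimately have "x \<cdot> y \<sqsubseteq> z \<boxplus> \<^bold>0"
      using cl by (meson le_trans)
    then show "x \<cdot> y \<sqsubseteq> z"
      using z by (simp add: add_zero_right)
  }
qed

text \<open>Since \<open>e\<close> reflects the order, an inequality of \<open>A\<close> can be
  residuated in \<open>C\<close>, even when \<open>y\<close> has no complement in
  \<open>A\<close>.\<close>

lemma embedding_mult_le_iff:
  assumes "comm_bimonoid A" and "comm_bimonoid C" and "bimonoid_embedding A C e"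
    and "x \<in> carrier A" and "y \<in> carrier A" and "z \<in> carrier A" and "is_complement C (e y) c"
  shows "x \<cdot>\<^bsub>A\<^esub> y \<sqsubseteq>\<^bsub>A\<^esub> z \<longleftrightarrow> e x \<sqsubseteq>\<^bsub>C\<^esub> e z \<boxplus>\<^bsub>C\<^esub> c"
proof -
  interpret A: comm_bimonoid A by fact
  interpret C: comm_bimonoid C by fact
  have "x \<cdot>\<^bsub>A\<^esub> y \<sqsubseteq>\<^bsub>A\<^esub> z \<longleftrightarrow> e (x \<cdot>\<^bsub>A\<^esub> y) \<sqsubseteq>\<^bsub>C\<^esub> e z"
    using assms A.mult_closed unfolding bimonoid_embedding_def by blast
  also have "\<dots> \<longleftrightarrow> e x \<cdot>\<^bsub>C\<^esub> e y \<sqsubseteq>\<^bsub>C\<^esub> e z"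
    using assms by (simp add: bimonoid_embedding_def bimonoid_hom_def)
  also have "\<dots> \<longleftrightarrow> e x \<sqsubseteq>\<^bsub>C\<^esub> e z \<boxplus>\<^bsub>C\<^esub> c"
    using assms
    by (intro C.mult_le_iff_le_add_complement) (auto simp: bimonoid_embedding_def bimonoid_hom_def)
  finally show ?thesis .
qed

lemma all_joins_admissible_if_join_preserving_embedding:
  assumes A: "comm_bimonoid A" and D: "comm_bimonoid D" and compl: "complemented D"
    and e: "bimonoid_embedding A D e" and pres: "preserves_joins A D e"
  shows "all_joins_admissible A"
  unfolding all_joins_admissible_def
proof (intro allI impI)
  interpret A: comm_bimonoid A by (rule A)
  interpret D: comm_bimonoid D by (rule D)
  have e_closed: "e x \<in> carrier D" if "x \<in> carrier A" for x
    using e that by (auto simp: bimonoid_embedding_def bimonoid_hom_def)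
  fix X s
  assume X: "X \<subseteq> carrier A" and lub: "is_lub A s X"
  have s: "s \<in> carrier A" and ub: "\<forall>x\<in>X. x \<sqsubseteq>\<^bsub>A\<^esub> s"
    using lub unfolding is_lub_iff[OF X] by auto
  have eX: "e ` X \<subseteq> carrier D"
    using X e_closed by auto
  have elub: "is_lub D (e s) (e ` X)"
    using pres X lub unfolding preserves_joins_def by blast
  have "is_lub A (s \<cdot>\<^bsub>A\<^esub> y) ((\<lambda>x. x \<cdot>\<^bsub>A\<^esub> y) ` X)" if y: "y \<in> carrier A" for y
  proof -
    obtain c where c: "is_complement D (e y) c"
      using compl e_closed[OF y] by (auto simp: complemented_def)
    then have c_closed: "c \<in> carrier D"
      by (simp add: is_complement_def)
    have "s \<cdot>\<^bsub>A\<^esub> y \<sqsubseteq>\<^bsub>A\<^esub> u"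
      if u: "u \<in> carrier A" and bound: "\<And>x. x \<in> X \<Longrightarrow> x \<cdot>\<^bsub>A\<^esub> y \<sqsubseteq>\<^bsub>A\<^esub> u" for u
    proof -
      have "e x \<sqsubseteq>\<^bsub>D\<^esub> e u \<boxplus>\<^bsub>D\<^esub> c" if "x \<in> X" for x
        using embedding_mult_le_iff[OF A D e subsetD[OF X that] y u c] bound[OF that] by simp
      then have "e s \<sqsubseteq>\<^bsub>D\<^esub> e u \<boxplus>\<^bsub>D\<^esub> c"
        using elub D.add_closed[OF e_closed[OF u] c_closed] unfolding is_lub_iff[OF eX] by blast
      then show ?thesis
        using embedding_mult_le_iff[OF A D e s y u c] by simp
    qed
    moreover have "x \<cdot>\<^bsub>A\<^esub> y \<sqsubseteq>\<^bsub>A\<^esub> s \<cdot>\<^bsub>A\<^esub> y" if "x \<in> X" for x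
      using that X s y ub by (intro A.mult_mono) auto
    moreover have "(\<lambda>x. x \<cdot>\<^bsub>A\<^esub> y) ` X \<subseteq> carrier A"
      using X y A.mult_closed by auto
    ultimately show ?thesis
      using s y A.mult_closed by (simp add: is_lub_iff)
  qed
  with lub show "admissible_join A s X"
    by (simp add: admissible_join_def)
qed

lemma Delta1_extension_preserves_joins_if_admissible:
  assumes ext: "comm_Delta1_extension A C e" and adm: "all_joins_admissible A"
  shows "preserves_joins A C e"
  unfolding preserves_joins_def
proof (intro allI impI)
  have A: "comm_bimonoid A" and C: "comm_bimonoid C" and e: "bimonoid_embedding A C e"
    and dense: "meet_dense C {e a \<boxplus>\<^bsub>C\<^esub> c | a b c.
      a \<in> carrier A \<and> b \<in> carrier A \<and> is_complement C (e b) c}" (is "meet_dense C ?M")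
    using ext by (auto simp: comm_Delta1_extension_def)
  interpret A: comm_bimonoid A by (rule A)
  interpret C: comm_bimonoid C by (rule C)
  have e_closed: "e x \<in> carrier C" if "x \<in> carrier A" for x
    using e that by (auto simp: bimonoid_embedding_def bimonoid_hom_def)
  fix X s
  assume X: "X \<subseteq> carrier A" and lub: "is_lub A s X"
  have s: "s \<in> carrier A" and ub: "\<forall>x\<in>X. x \<sqsubseteq>\<^bsub>A\<^esub> s"
    using lub unfolding is_lub_iff[OF X] by auto
  have eX: "e ` X \<subseteq> carrier C"
    using X e_closed by auto
  have "e s \<sqsubseteq>\<^bsub>C\<^esub> d" if d: "d \<in> carrier C" and bound: "\<And>x. x \<in> X \<Longrightarrow> e x \<sqsubseteq>\<^bsub>C\<^esub> d" for d
  proof -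
    \<comment> \<open>Writing the arbitrary bound \<open>d\<close> as a meet of generators reduces
      the claim to \<open>e s \<sqsubseteq> m\<close> for each \<open>m\<close> in
      \<open>Y\<close>.\<close>
    obtain Y where Y: "Y \<subseteq> ?M" and glb: "is_glb C d Y"
      using dense d unfolding meet_dense_def by blast
    have YC: "Y \<subseteq> carrier C"
      using dense by (intro subset_trans[OF Y]) (simp only: meet_dense_def)
    have "e s \<sqsubseteq>\<^bsub>C\<^esub> m" if m: "m \<in> Y" for m
    proof -
      obtain a b c where a: "a \<in> carrier A" and b: "b \<in> carrier A"
        and c: "is_complement C (e b) c" and m_eq: "m = e a \<boxplus>\<^bsub>C\<^esub> c"
        using Y m by blast
      note residuate = embedding_mult_le_iff[OF A C e _ b a c]
      have "d \<sqsubseteq>\<^bsub>C\<^esub> m"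
        using glb m unfolding is_glb_iff[OF YC] by blast
      then have "e x \<sqsubseteq>\<^bsub>C\<^esub> e a \<boxplus>\<^bsub>C\<^esub> c" if "x \<in> X" for x
        unfolding m_eq[symmetric]
        by (rule C.le_trans[OF bound[OF that]]) (use that eX d m YC in auto)
      then have *: "x \<cdot>\<^bsub>A\<^esub> b \<sqsubseteq>\<^bsub>A\<^esub> a" if "x \<in> X" for x
        using residuate[OF subsetD[OF X that]] that by simp
      \<comment> \<open>Admissibility enters here: \<open>a\<close> bounds all products
        \<open>x \<cdot> b\<close>, hence also \<open>s \<cdot> b\<close>.\<close>
      have "is_lub A (s \<cdot>\<^bsub>A\<^esub> b) ((\<lambda>x. x \<cdot>\<^bsub>A\<^esub> b) ` X)"
        using adm X lub b unfolding all_joins_admissible_def admissible_join_def by blast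
      moreover have "(\<lambda>x. x \<cdot>\<^bsub>A\<^esub> b) ` X \<subseteq> carrier A"
        using X b A.mult_closed by auto
      ultimately have "s \<cdot>\<^bsub>A\<^esub> b \<sqsubseteq>\<^bsub>A\<^esub> a"
        using * a by (simp add: is_lub_iff)
      then show ?thesis
        using residuate[OF s] m_eq by simp
    qed
    then show ?thesis
      using glb e_closed[OF s] unfolding is_glb_iff[OF YC] by blast
  qed
  moreover have "e x \<sqsubseteq>\<^bsub>C\<^esub> e s" if "x \<in> X" for x
    using e subsetD[OF X that] s bspec[OF ub that] by (simp add: bimonoid_embedding_def)
  ultimately show "is_lub C (e s) (e ` X)"
    using e_closed[OF s] by (simp add: is_lub_iff[OF eX])
qed

text \<open>A formula cannot quantify over types, so condition (iii) appears twice: over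
  \<open>'c\<close>, where \<open>A\<Delta>\<close> itself is a witness, and over an arbitrary
  \<open>'d\<close>, where it still implies (i).\<close>

theorem mainTheorem9:
  fixes A :: "'a bimonoid" and A\<Delta> :: "'c bimonoid" and \<iota> :: "'a \<Rightarrow> 'c"
  assumes "comm_bimonoid A"
    and "comm_complemented_DM_completion A A\<Delta> \<iota>"
  shows "(all_joins_admissible A \<longleftrightarrow> preserves_joins A A\<Delta> \<iota>) \<and>
    (preserves_joins A A\<Delta> \<iota> \<longleftrightarrow>
      (\<exists>(D :: 'c bimonoid) e. comm_complete_complemented_bimonoid D \<and>
        bimonoid_embedding A D e \<and> preserves_joins A D e)) \<and>
    ((\<exists>(D :: 'd bimonoid) e. comm_complete_complemented_bimonoid D \<and>
        bimonoid_embedding A D e \<and> preserves_joins A D e) \<longrightarrow> all_joins_admissible A)"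
proof -
  have ext: "comm_Delta1_extension A A\<Delta> \<iota>"
    and complete: "comm_complete_complemented_bimonoid A\<Delta>"
    using assms(2) by (auto simp: comm_complemented_DM_completion_def)
  have emb: "bimonoid_embedding A A\<Delta> \<iota>"
    using ext by (simp add: comm_Delta1_extension_def)
  have to_pres: "all_joins_admissible A \<Longrightarrow> preserves_joins A A\<Delta> \<iota>"
    by (rule Delta1_extension_preserves_joins_if_admissible[OF ext])
  \<comment> \<open>Both \<open>'c\<close> and \<open>'d\<close> are fixed inside the proof, so the
    implication is instantiated once for each.\<close>
  have to_adm_c: "all_joins_admissible A"
    if "comm_complete_complemented_bimonoid D" "bimonoid_embedding A D e" "preserves_joins A D e"
    for D :: "'c bimonoid" and e
    using that all_joins_admissible_if_join_preserving_embedding[OF assms(1)]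
    unfolding comm_complete_complemented_bimonoid_def by blast
  have to_adm_d: "all_joins_admissible A"
    if "comm_complete_complemented_bimonoid D" "bimonoid_embedding A D e" "preserves_joins A D e"
    for D :: "'d bimonoid" and e
    using that all_joins_admissible_if_join_preserving_embedding[OF assms(1)]
    unfolding comm_complete_complemented_bimonoid_def by blast
  show ?thesis
    using to_pres to_adm_c to_adm_d complete emb by blast
qed

end
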